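(* Let $(\mathcal{X}, \mathcal{S}, \mu)$ be a probability space and let $\mathcal{C} \subseteq \mathcal{S}$ be a family of measurable sets. If $\mathcal{C}$ is a separable VC-class, then the bracketing number $N_{[\,]}(\epsilon, \mathcal{C}, \mu)$ is finite for every $\epsilon > 0$.
   Context: VC dimension: a family $\mathcal{C}$ of subsets of $\mathcal{X}$ shatters a finite set $D \subseteq \mathcal{X}$ if $|\{C \cap D : C \in \mathcal{C}\}| = 2^{|D|}$. The VC dimension $\dim(\mathcal{C})$ is the largest integer $k$ such that $\mathcal{C}$ shatters some set of cardinality $k$ ($+\infty$ if $\mathcal{C}$ shatters arbitrarily large finite sets). $\mathcal{C}$ is a VC-class if $\dim(\mathcal{C}) < \infty$. Separability: a family $\mathcal{F}$ of measurable functions $f : \mathcal{X} \to \mathbb{R}$ is separable if there is a countable sub-family $\mathcal{F}_0 \subseteq \mathcal{F}$ such that each $f \in \mathcal{F}$ is a pointwise limit of a sequence of functions in $\mathcal{F}_0$. Bracketing: for measurable $g, h : \mathcal{X} \to \mathbb{R}$ with $g \leq h$, the bracket $[g,h]$ is the set of all measurable functions $f$ with $g \leq f \leq h$ pointwise on $\mathcal{X}$; it is an $\epsilon$-bracket if $\int (h-g)\, d\mu \leq \epsilon$. The bracketing number $N_{[\,]}(\epsilon, \mathcal{F}, \mu)$ is the least number of $\epsilon$-brackets needed to cover $\mathcal{F}$ (the functions $g,h$ need not belong to $\mathcal{F}$). These notions are applied to a family of sets $\mathcal{C}$ by identifying each $C \in \mathcal{C}$ with its indicator function. *)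

theory Defs
  imports "HOL-Probability.Probability"
begin

definition shatters :: "'a set set \<Rightarrow> 'a set \<Rightarrow> bool" where
  "shatters \<C> D \<longleftrightarrow> finite D \<and> card {C \<inter> D | C. C \<in> \<C>} = 2 ^ card D"

text \<open>The supremum in \<^typ>\<open>enat\<close> is the largest cardinality of a shattered set if there is one,
  and \<open>\<infinity>\<close> if arbitrarily large finite sets are shattered. The empty family shatters no set
  at all; it gets dimension \<open>0\<close>.\<close>

definition vc_dim :: "'a set \<Rightarrow> 'a set set \<Rightarrow> enat" where
  "vc_dim X \<C> = Sup {enat (card D) | D. D \<subseteq> X \<and> shatters \<C> D}"

definition VC_class :: "'a set \<Rightarrow> 'a set set \<Rightarrow> bool" where
  "VC_class X \<C> \<longleftrightarrow> vc_dim X \<C> < \<infinity>"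

definition separable_family :: "'a set \<Rightarrow> ('a \<Rightarrow> real) set \<Rightarrow> bool" where
  "separable_family X \<F> \<longleftrightarrow>
     (\<exists>\<F>\<^sub>0 \<subseteq> \<F>. countable \<F>\<^sub>0 \<and>
        (\<forall>f\<in>\<F>. \<exists>s :: nat \<Rightarrow> 'a \<Rightarrow> real. (\<forall>n. s n \<in> \<F>\<^sub>0) \<and> (\<forall>x\<in>X. (\<lambda>n. s n x) \<longlonglongrightarrow> f x)))"

definition bracket :: "'a measure \<Rightarrow> ('a \<Rightarrow> real) \<Rightarrow> ('a \<Rightarrow> real) \<Rightarrow> ('a \<Rightarrow> real) set" where
  "bracket M g h = {f \<in> borel_measurable M. \<forall>x\<in>space M. g x \<le> f x \<and> f x \<le> h x}"

text \<open>Integrability is required explicitly because the Bochner integral of a non-integrable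
  function is \<open>0\<close>; for \<open>g \<le> h\<close> it says precisely that the integral of \<open>h - g\<close> is not \<open>\<infinity>\<close>.\<close>

definition eps_bracket :: "real \<Rightarrow> 'a measure \<Rightarrow> ('a \<Rightarrow> real) set \<Rightarrow> bool" where
  "eps_bracket \<epsilon> M B \<longleftrightarrow>
     (\<exists>g\<in>borel_measurable M. \<exists>h\<in>borel_measurable M.
        (\<forall>x\<in>space M. g x \<le> h x) \<and> B = bracket M g h \<and>
        integrable M (\<lambda>x. h x - g x) \<and> (\<integral>x. h x - g x \<partial>M) \<le> \<epsilon>)"

text \<open>If no finite cover exists, this is the infimum of the empty set in \<^typ>\<open>enat\<close>, that is \<open>\<infinity>\<close>.\<close>

definition bracketing_number :: "real \<Rightarrow> ('a \<Rightarrow> real) set \<Rightarrow> 'a measure \<Rightarrow> enat" where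
  "bracketing_number \<epsilon> \<F> M =
     Inf {enat (card \<B>) | \<B>. finite \<B> \<and> (\<forall>B\<in>\<B>. eps_bracket \<epsilon> M B) \<and> \<F> \<subseteq> \<Union>\<B>}"

abbreviation indicators :: "'a set set \<Rightarrow> ('a \<Rightarrow> real) set" where
  "indicators \<C> \<equiv> (\<lambda>C. indicator C) ` \<C>"

end

(* Reduce to a countable subfamily \<C>\<^sub>0 and suppose that it is not a finite union of subfamilies
   with small oscillation (union minus intersection).  Call a subfamily bad if it is not such a
   union; if a bad family is a finite union, one of the parts is bad.  A decreasing sequence of bad
   families whose oscillations nearly have the least possible measure yields a limit set A of
   positive measure.  Members of \<C>\<^sub>0 that contain, or miss, a nonnull subset B of A up to a
   null set have by countability jointly no oscillation on B, so far along the sequence they do not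
   form a bad family.  Hence finitely many nonnull subsets of A are always split simultaneously by
   some member of \<C>\<^sub>0.  Iterating, one gets arbitrarily many members whose Boolean atoms are
   all nonempty, which contradicts finite VC dimension by the usual duality. *)

theory Submission
  imports Defs
begin

section \<open>Oscillation of a family and covers by pieces of small oscillation\<close>

definition oscillation :: "'a set set \<Rightarrow> 'a set" where
  "oscillation \<U> = \<Union>\<U> - \<Inter>\<U>"

text \<open>Each piece will yield the bracket between the indicators of its intersection and its
  union, whose size is the measure of the oscillation. The equality
  \<open>\<Union>\<W> = \<U>\<close> makes the pieces subfamilies, so they inherit countability and
  measurability.\<close>

definition osc_coverable :: "real \<Rightarrow> 'a measure \<Rightarrow> 'a set set \<Rightarrow> bool" where
  "osc_coverable \<epsilon> M \<U> \<longleftrightarrow>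
     (\<exists>\<W>. finite \<W> \<and> \<Union>\<W> = \<U> \<and> (\<forall>\<V>\<in>\<W>. measure M (oscillation \<V>) \<le> \<epsilon>))"

lemma oscillation_mono: "\<U> \<subseteq> \<V> \<Longrightarrow> oscillation \<U> \<subseteq> oscillation \<V>"
  unfolding oscillation_def by blast

lemma sets_oscillation:
  assumes "countable \<U>" "\<U> \<subseteq> sets M"
  shows "oscillation \<U> \<in> sets M"
\<comment> \<open>\<open>\<Inter>{}\<close> is \<open>UNIV\<close>, which need not be measurable,
  but the oscillation of the empty family is empty.\<close>
proof (cases "\<U> = {}")
  case False
  then have "\<Inter>\<U> \<in> sets M"
    using assms sets.countable_INT'[of \<U> id M] by simp
  moreover have "\<Union>\<U> \<in> sets M"
    using assms by (rule sets.countable_Union)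
  ultimately show ?thesis by (simp add: oscillation_def)
qed (simp add: oscillation_def)

lemma osc_coverable_small:
  "measure M (oscillation \<U>) \<le> \<epsilon> \<Longrightarrow> osc_coverable \<epsilon> M \<U>"
  unfolding osc_coverable_def by (rule exI[of _ "{\<U>}"]) simp

lemma osc_coverable_Union:
  assumes "finite I" "\<And>i. i \<in> I \<Longrightarrow> osc_coverable \<epsilon> M (\<U> i)"
  shows "osc_coverable \<epsilon> M (\<Union>i\<in>I. \<U> i)"
proof -
  obtain \<W> where \<W>: "\<And>i. i \<in> I \<Longrightarrow> finite (\<W> i) \<and> \<Union>(\<W> i) = \<U> i \<and>
      (\<forall>\<V>\<in>\<W> i. measure M (oscillation \<V>) \<le> \<epsilon>)"
    using assms(2) unfolding osc_coverable_def by metis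
  have "\<Union>(\<Union>i\<in>I. \<W> i) = (\<Union>i\<in>I. \<Union>(\<W> i))"
    by blast
  also have "\<dots> = (\<Union>i\<in>I. \<U> i)"
    using \<W> by simp
  finally have "\<Union>(\<Union>i\<in>I. \<W> i) = (\<Union>i\<in>I. \<U> i)" .
  with \<W> show ?thesis
    unfolding osc_coverable_def using assms(1)
    by (intro exI[of _ "\<Union>i\<in>I. \<W> i"]) simp
qed

lemma osc_coverable_Un:
  assumes "osc_coverable \<epsilon> M \<U>" "osc_coverable \<epsilon> M \<V>"
  shows "osc_coverable \<epsilon> M (\<U> \<union> \<V>)"
  using osc_coverable_Union[of "{\<U>, \<V>}" \<epsilon> M id] assms by auto

section \<open>Simultaneous splitting by families that are not coverable\<close>

context finite_measure
begin

text \<open>The infimum need not be attained, so \<open>V\<close> is only taken within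
  \<open>e\<close> of the infimum over all subfamilies of \<open>U\<close> satisfying
  \<open>P\<close>. Those of \<open>V\<close> are among them.\<close>

lemma exists_almost_minimal:
  fixes e :: real
  assumes "P U" "0 < e"
  obtains V where "V \<subseteq> U" "P V"
    "\<And>W. W \<subseteq> V \<Longrightarrow> P W \<Longrightarrow> measure M (oscillation V) - e \<le> measure M (oscillation W)"
proof -
  define S where "S = (\<lambda>W. measure M (oscillation W)) ` {W. W \<subseteq> U \<and> P W}"
  have "S \<noteq> {}" "bdd_below S"
    using assms(1) by (auto simp: S_def intro!: bdd_belowI[of _ 0])
  then have "\<exists>y\<in>S. y < Inf S + e"
    using cInf_less_iff[of S "Inf S + e"] assms(2) by simp
  then obtain V where V: "V \<subseteq> U" "P V" "measure M (oscillation V) < Inf S + e"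
    unfolding S_def by blast
  have "Inf S \<le> measure M (oscillation W)" if "W \<subseteq> V" "P W" for W
    using that V(1) \<open>bdd_below S\<close> by (intro cInf_lower) (auto simp: S_def)
  then have "measure M (oscillation V) - e \<le> measure M (oscillation W)" if "W \<subseteq> V" "P W" for W
    using V(3) that by (smt (verit))
  with V(1,2) show thesis by (rule that)
qed

text \<open>A point of the oscillation lies in some member and outside another. So the part in
  \<open>B\<close> is covered by the sets \<open>B \<inter> D\<close>, and also by the sets
  \<open>B - D\<close>; one of these two countable unions is null.\<close>

lemma measure_Int_oscillation_eq_0:
  assumes "countable \<U>" "\<U> \<subseteq> sets M" "B \<in> sets M"
    and "(\<forall>D\<in>\<U>. measure M (B \<inter> D) = 0) \<or> (\<forall>D\<in>\<U>. measure M (B - D) = 0)"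
  shows "measure M (B \<inter> oscillation \<U>) = 0"
  using assms(4)
proof
  assume null: "\<forall>D\<in>\<U>. measure M (B \<inter> D) = 0"
  have "(\<Union>D\<in>\<U>. B \<inter> D) \<in> null_sets M"
    using assms null by (intro null_sets_UN') (auto simp: null_sets_def emeasure_eq_measure)
  moreover have "B \<inter> oscillation \<U> \<subseteq> (\<Union>D\<in>\<U>. B \<inter> D)"
    by (auto simp: oscillation_def)
  ultimately show ?thesis
    using assms by (meson null_sets_subset measure_eq_0_null_sets sets.Int sets_oscillation)
next
  assume null: "\<forall>D\<in>\<U>. measure M (B - D) = 0"
  have "(\<Union>D\<in>\<U>. B - D) \<in> null_sets M"
    using assms null by (intro null_sets_UN') (auto simp: null_sets_def emeasure_eq_measure)
  moreover have "B \<inter> oscillation \<U> \<subseteq> (\<Union>D\<in>\<U>. B - D)"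
    by (auto simp: oscillation_def)
  ultimately show ?thesis
    using assms by (meson null_sets_subset measure_eq_0_null_sets sets.Int sets_oscillation)
qed

text \<open>Meant for \<open>\<B>\<close> the collection of Boolean atoms built so far: a single
  \<open>D\<close> cuts all of them into two nonnull halves.\<close>

lemma splittable_set_if_not_osc_coverable:
  assumes "countable \<C>" "\<C> \<subseteq> sets M" "0 < \<epsilon>" "\<not> osc_coverable \<epsilon> M \<C>"
  obtains A where "A \<in> sets M" "0 < measure M A"
    "\<And>\<B>. finite \<B> \<Longrightarrow> \<B> \<subseteq> sets M \<Longrightarrow> (\<And>B. B \<in> \<B> \<Longrightarrow> B \<subseteq> A \<and> 0 < measure M B) \<Longrightarrow>
       \<exists>D\<in>\<C>. \<forall>B\<in>\<B>. 0 < measure M (B \<inter> D) \<and> 0 < measure M (B - D)"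
proof -
  define bad where "bad \<U> \<longleftrightarrow> \<U> \<subseteq> \<C> \<and> \<not> osc_coverable \<epsilon> M \<U>" for \<U>
  \<comment> \<open>The slack tends to 0, so for large \<open>n\<close> it is below the measure of
    each of finitely many given nonnull sets.\<close>
  define almost_min where "almost_min n \<U> \<longleftrightarrow>
      (\<forall>\<W>\<subseteq>\<U>. bad \<W> \<longrightarrow> measure M (oscillation \<U>) - inverse (real (Suc n)) \<le> measure M (oscillation \<W>))"
    for n \<U>
  have step: "\<exists>\<V>. (bad \<V> \<and> almost_min n \<V>) \<and> \<V> \<subseteq> \<U>" if "bad \<U>" for n \<U>
    by (rule exists_almost_minimal[of bad \<U> "inverse (real (Suc n))"])
       (use that in \<open>auto simp: almost_min_def\<close>)
  have "\<exists>\<U>. \<forall>n. (bad (\<U> n) \<and> almost_min n (\<U> n)) \<and> \<U> (Suc n) \<subseteq> \<U> n"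
  proof (rule dependent_nat_choice)
    show "\<exists>\<U>. bad \<U> \<and> almost_min 0 \<U>"
      using step[of \<C> 0] assms(4) by (auto simp: bad_def)
  qed (use step in blast)
  then obtain \<U> where bad: "\<And>n. bad (\<U> n)" and min: "\<And>n. almost_min n (\<U> n)"
      and dec: "\<And>n. \<U> (Suc n) \<subseteq> \<U> n"
    by blast
  have osc_sets: "oscillation \<W> \<in> sets M" if "\<W> \<subseteq> \<C>" for \<W>
    using that assms(1,2) by (intro sets_oscillation) (auto intro: countable_subset)
  define A where "A = (\<Inter>n. oscillation (\<U> n))"
  have U_sets: "oscillation (\<U> n) \<in> sets M" for n
    using bad osc_sets by (auto simp: bad_def)
  have A_sets: "A \<in> sets M"
    unfolding A_def using U_sets by auto
  have "(\<lambda>n. measure M (oscillation (\<U> n))) \<longlonglongrightarrow> measure M A"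
    unfolding A_def using U_sets
    by (intro finite_Lim_measure_decseq) (auto intro!: decseq_SucI oscillation_mono dec)
  \<comment> \<open>A family with oscillation at most \<open>\<epsilon>\<close> is its own cover,
    hence not bad.\<close>
  moreover have "\<epsilon> \<le> measure M (oscillation (\<U> n))" for n
    using bad[of n] osc_coverable_small[of M "\<U> n" \<epsilon>] by (force simp: bad_def)
  ultimately have "\<epsilon> \<le> measure M A"
    by (intro LIMSEQ_le_const) auto
  \<comment> \<open>\<open>B\<close> lies in \<open>oscillation (\<U> n)\<close> but meets
    \<open>oscillation \<W>\<close> in a null set. If \<open>\<W>\<close> were bad, the gap between
    the measures of the two oscillations, at least \<open>measure M B\<close>, would exceed the
    slack of \<open>almost_min n\<close>.\<close>
  have not_bad: "\<not> bad \<W>" 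
    if B: "B \<in> sets M" "B \<subseteq> A" "inverse (real (Suc n)) < measure M B" and "\<W> \<subseteq> \<U> n"
      and "(\<forall>D\<in>\<W>. measure M (B \<inter> D) = 0) \<or> (\<forall>D\<in>\<W>. measure M (B - D) = 0)" for B n \<W>
  proof
    assume "bad \<W>"
    then have "\<W> \<subseteq> \<C>" by (simp add: bad_def)
    have null: "measure M (B \<inter> oscillation \<W>) = 0"
      using that \<open>\<W> \<subseteq> \<C>\<close> assms(1,2)
      by (intro measure_Int_oscillation_eq_0) (auto intro: countable_subset)
    have "measure M B + measure M (oscillation \<W>) = measure M (B \<union> oscillation \<W>)"
      using null B(1) osc_sets[OF \<open>\<W> \<subseteq> \<C>\<close>] by (simp add: measure_Un3 fmeasurable_eq_sets)
    also have "\<dots> \<le> measure M (oscillation (\<U> n))"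
      using B(2) U_sets oscillation_mono[OF \<open>\<W> \<subseteq> \<U> n\<close>] by (intro finite_measure_mono) (auto simp: A_def)
    also have "\<dots> \<le> measure M (oscillation \<W>) + inverse (real (Suc n))"
      using min[of n, unfolded almost_min_def, rule_format, OF \<open>\<W> \<subseteq> \<U> n\<close> \<open>bad \<W>\<close>] by linarith
    finally show False using B(3) by simp
  qed
  show thesis
  proof (rule that)
    show "A \<in> sets M" by fact
    show "0 < measure M A" using \<open>\<epsilon> \<le> measure M A\<close> assms(3) by simp
    fix \<B> assume \<B>: "finite \<B>" "\<B> \<subseteq> sets M" "\<And>B. B \<in> \<B> \<Longrightarrow> B \<subseteq> A \<and> 0 < measure M B"
    have "eventually (\<lambda>n. inverse (real (Suc n)) < measure M B) sequentially" if "B \<in> \<B>" for B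
      using \<B>(3)[OF that] LIMSEQ_inverse_real_of_nat by (intro order_tendstoD) auto
    then have "eventually (\<lambda>n. \<forall>B\<in>\<B>. inverse (real (Suc n)) < measure M B) sequentially"
      using \<B>(1) by (simp add: eventually_ball_finite)
    then obtain n where n: "\<And>B. B \<in> \<B> \<Longrightarrow> inverse (real (Suc n)) < measure M B"
      using eventually_happens'[OF sequentially_bot] by blast
    \<comment> \<open>\<open>\<W> B\<close> collects the members of \<open>\<U> n\<close> that fail
      to split \<open>B\<close>. By \<open>not_bad\<close> both halves are coverable, so finitely
      many such families cannot exhaust the bad family \<open>\<U> n\<close>.\<close>
    define \<W> where "\<W> B = {D \<in> \<U> n. measure M (B \<inter> D) = 0} \<union> {D \<in> \<U> n. measure M (B - D) = 0}" for B
    have "\<U> n \<subseteq> \<C>" using bad[of n] by (simp add: bad_def)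
    have "osc_coverable \<epsilon> M (\<W> B)" if "B \<in> \<B>" for B
    proof -
      have "\<not> bad {D \<in> \<U> n. measure M (B \<inter> D) = 0}" "\<not> bad {D \<in> \<U> n. measure M (B - D) = 0}"
        using \<B>(2,3) n that by (intro not_bad[of B n]; auto)+
      then show ?thesis
        unfolding \<W>_def bad_def using \<open>\<U> n \<subseteq> \<C>\<close> by (intro osc_coverable_Un) auto
    qed
    then have "osc_coverable \<epsilon> M (\<Union>B\<in>\<B>. \<W> B)"
      using \<B>(1) by (intro osc_coverable_Union)
    then have "(\<Union>B\<in>\<B>. \<W> B) \<noteq> \<U> n"
      using bad[of n] by (auto simp: bad_def)
    then obtain D where "D \<in> \<U> n" "\<And>B. B \<in> \<B> \<Longrightarrow> D \<notin> \<W> B"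
      by (auto simp: \<W>_def)
    then show "\<exists>D\<in>\<C>. \<forall>B\<in>\<B>. 0 < measure M (B \<inter> D) \<and> 0 < measure M (B - D)"
      using \<open>\<U> n \<subseteq> \<C>\<close> by (intro bexI[of _ D]) (auto simp: \<W>_def zero_less_measure_iff)
  qed
qed

text \<open>Induction on \<open>I\<close> with a stronger claim: all atoms inside \<open>A\<close>
  are measurable and nonnull. A new index receives a member that splits all of them at once.\<close>

lemma independent_members_if_not_osc_coverable:
  assumes "countable \<C>" "\<C> \<subseteq> sets M" "0 < \<epsilon>" "\<not> osc_coverable \<epsilon> M \<C>" "finite I"
  shows "\<exists>C. C ` I \<subseteq> \<C> \<and> (\<forall>T\<subseteq>I. \<exists>x\<in>space M. \<forall>i\<in>I. x \<in> C i \<longleftrightarrow> i \<in> T)"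
proof -
  obtain A where A: "A \<in> sets M" "0 < measure M A"
    and split: "\<And>\<B>. finite \<B> \<Longrightarrow> \<B> \<subseteq> sets M \<Longrightarrow> (\<And>B. B \<in> \<B> \<Longrightarrow> B \<subseteq> A \<and> 0 < measure M B) \<Longrightarrow>
       \<exists>D\<in>\<C>. \<forall>B\<in>\<B>. 0 < measure M (B \<inter> D) \<and> 0 < measure M (B - D)"
    using splittable_set_if_not_osc_coverable[OF assms(1-4)] by blast
  \<comment> \<open>Confining atoms to \<open>A\<close> keeps \<open>split\<close> applicable; for
    empty \<open>I\<close> the only atom is \<open>A\<close>.\<close>
  define atom where "atom C I T = {x \<in> A. \<forall>i\<in>I. x \<in> C i \<longleftrightarrow> i \<in> T}" for C :: "'b \<Rightarrow> 'a set" and I T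
  have "\<exists>C. C ` I \<subseteq> \<C> \<and> (\<forall>T\<subseteq>I. atom C I T \<in> sets M \<and> 0 < measure M (atom C I T))"
    using \<open>finite I\<close>
  proof induction
    case empty
    then show ?case using A by (simp add: atom_def)
  next
    case (insert i I)
    then obtain C where C: "C ` I \<subseteq> \<C>"
      and atoms: "\<And>T. T \<subseteq> I \<Longrightarrow> atom C I T \<in> sets M \<and> 0 < measure M (atom C I T)"
      by blast
    have "\<exists>D\<in>\<C>. \<forall>B\<in>atom C I ` Pow I. 0 < measure M (B \<inter> D) \<and> 0 < measure M (B - D)"
      using insert.hyps(1) atoms by (intro split) (auto simp: atom_def)
    then obtain D where D: "D \<in> \<C>"
      "\<And>T. T \<subseteq> I \<Longrightarrow> 0 < measure M (atom C I T \<inter> D) \<and> 0 < measure M (atom C I T - D)"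
      by blast
    have "atom (C(i := D)) (insert i I) T \<in> sets M \<and> 0 < measure M (atom (C(i := D)) (insert i I) T)"
      if "T \<subseteq> insert i I" for T
    proof -
      \<comment> \<open>As \<open>i\<close> is not in \<open>I\<close>, the update keeps the old
        atoms, and \<open>D\<close> cuts each into the new atom with \<open>i\<close> and the one
        without.\<close>
      have "atom (C(i := D)) (insert i I) T =
          (if i \<in> T then atom C I (T - {i}) \<inter> D else atom C I (T - {i}) - D)"
        using insert.hyps(2) by (auto simp: atom_def)
      moreover have "T - {i} \<subseteq> I" using that by blast
      ultimately show ?thesis
        using D atoms assms(2) by auto
    qed
    moreover have "C(i := D) ` insert i I \<subseteq> \<C>"
      using C D(1) insert.hyps(2) by auto
    ultimately show ?case by blast
  qed
  then obtain C where "C ` I \<subseteq> \<C>"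
    and C: "\<forall>T\<subseteq>I. atom C I T \<in> sets M \<and> 0 < measure M (atom C I T)"
    by (elim exE conjE)
  moreover have "\<exists>x\<in>space M. \<forall>i\<in>I. x \<in> C i \<longleftrightarrow> i \<in> T" if "T \<subseteq> I" for T
  proof -
    have "0 < measure M (atom C I T)" using C that by simp
    then have "atom C I T \<noteq> {}" by auto
    then show ?thesis
      using sets.sets_into_space[OF A(1)] by (auto simp: atom_def)
  qed
  ultimately show ?thesis by blast
qed

end

section \<open>From independent members to shattered sets\<close>

text \<open>Index the independent family by the subsets of \<open>{..<n}\<close>; the point of the shattered set with
  number \<open>j\<close> is then taken from the atom that selects the indices containing \<open>j\<close>.\<close>

lemma shatters_if_independent:
  fixes C :: "nat set \<Rightarrow> 'a set"
  assumes "C ` Pow {..<n} \<subseteq> \<C>"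
    and "\<And>T. T \<subseteq> Pow {..<n} \<Longrightarrow> \<exists>x\<in>X. \<forall>i\<in>Pow {..<n}. x \<in> C i \<longleftrightarrow> i \<in> T"
  obtains D where "D \<subseteq> X" "card D = n" "shatters \<C> D"
proof -
  have "\<exists>x\<in>X. \<forall>i\<in>Pow {..<n}. x \<in> C i \<longleftrightarrow> j \<in> i" for j
  proof -
    have "{i \<in> Pow {..<n}. j \<in> i} \<subseteq> Pow {..<n}" by blast
    from assms(2)[OF this] show ?thesis by simp
  qed
  then have "\<forall>j. \<exists>x. x \<in> X \<and> (\<forall>i\<in>Pow {..<n}. x \<in> C i \<longleftrightarrow> j \<in> i)"
    by blast
  from choice[OF this] obtain x
    where "\<forall>j. x j \<in> X \<and> (\<forall>i\<in>Pow {..<n}. x j \<in> C i \<longleftrightarrow> j \<in> i)" ..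
  then have x: "\<And>j. x j \<in> X" "\<And>i j. i \<subseteq> {..<n} \<Longrightarrow> x j \<in> C i \<longleftrightarrow> j \<in> i"
    by simp_all
  define D where "D = x ` {..<n}"
  have "inj_on x {..<n}"
  proof (rule inj_onI)
    fix j k assume "j \<in> {..<n}" "k \<in> {..<n}" "x j = x k"
    \<comment> \<open>The member with index \<open>{j}\<close> contains \<open>x j\<close> and no
      other chosen point.\<close>
    then have "k \<in> {j} \<longleftrightarrow> j \<in> {j}"
      using x(2)[of "{j}"] by (metis empty_subsetI insert_subset)
    then show "j = k" by blast
  qed
  then have "card D = n" by (simp add: D_def card_image)
  \<comment> \<open>The set of numbers of the points in \<open>S\<close> is itself the index of a
    member that cuts out \<open>S\<close>.\<close>
  have "S \<in> {B \<inter> D | B. B \<in> \<C>}" if "S \<subseteq> D" for S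
  proof -
    from that obtain i where i: "i \<subseteq> {..<n}" "S = x ` i"
      unfolding D_def by (rule subset_imageE)
    have "S = C i \<inter> D"
      unfolding i(2) D_def using i(1) x(2)[OF i(1)] by blast
    moreover have "C i \<in> \<C>"
      using i(1) assms(1) by blast
    ultimately show ?thesis by blast
  qed
  then have "Pow D \<subseteq> {B \<inter> D | B. B \<in> \<C>}"
    unfolding Pow_def by (intro subsetI) (elim CollectE)
  moreover have "{B \<inter> D | B. B \<in> \<C>} \<subseteq> Pow D" by blast
  ultimately have "{B \<inter> D | B. B \<in> \<C>} = Pow D" by (rule equalityI[rotated])
  then have "shatters \<C> D"
    by (simp add: shatters_def card_Pow D_def)
  moreover have "D \<subseteq> X"
    unfolding D_def using x(1) by (rule image_subsetI)
  ultimately show thesis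
    using \<open>card D = n\<close> by (intro that)
qed

lemma VC_class_bound:
  assumes "VC_class X \<C>"
  obtains n where "\<And>D. D \<subseteq> X \<Longrightarrow> shatters \<C> D \<Longrightarrow> card D \<le> n"
proof -
  obtain n where n: "vc_dim X \<C> = enat n"
    using assms by (auto simp: VC_class_def)
  have "card D \<le> n" if "D \<subseteq> X" "shatters \<C> D" for D
  proof -
    have "enat (card D) \<le> vc_dim X \<C>"
      unfolding vc_dim_def using that by (intro Sup_upper) blast
    then show ?thesis by (simp add: n)
  qed
  then show thesis using that by blast
qed

text \<open>If \<open>n\<close> bounds the size of shattered sets, \<open>2 ^ Suc n\<close>
  independent members of \<open>\<C>\<^sub>0\<close>, indexed by \<open>Pow {..<Suc n}\<close>,
  would shatter \<open>Suc n\<close> points.\<close>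

lemma (in finite_measure) osc_coverable_if_VC_class:
  assumes "VC_class (space M) \<C>" "\<C>\<^sub>0 \<subseteq> \<C>" "countable \<C>\<^sub>0" "\<C>\<^sub>0 \<subseteq> sets M" "0 < \<epsilon>"
  shows "osc_coverable \<epsilon> M \<C>\<^sub>0"
proof (rule ccontr)
  assume not_cov: "\<not> osc_coverable \<epsilon> M \<C>\<^sub>0"
  obtain n where n: "\<And>D. D \<subseteq> space M \<Longrightarrow> shatters \<C> D \<Longrightarrow> card D \<le> n"
    using VC_class_bound[OF assms(1)] by blast
  obtain C where "C ` Pow {..<Suc n} \<subseteq> \<C>\<^sub>0"
    "\<forall>T\<subseteq>Pow {..<Suc n}. \<exists>x\<in>space M. \<forall>i\<in>Pow {..<Suc n}. x \<in> C i \<longleftrightarrow> i \<in> T"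
    using independent_members_if_not_osc_coverable[OF assms(3-5) not_cov, of "Pow {..<Suc n}"] by auto
  then obtain D where "D \<subseteq> space M" "card D = Suc n" "shatters \<C> D"
    using assms(2) shatters_if_independent[of C "Suc n" \<C> "space M"] by (metis order_trans)
  with n[of D] show False by simp
qed

section \<open>Brackets from pieces of small oscillation, and passage to limits\<close>

definition osc_bracket :: "'a measure \<Rightarrow> 'a set set \<Rightarrow> ('a \<Rightarrow> real) set" where
  "osc_bracket M \<V> = bracket M (indicator (\<Inter>\<V>)) (indicator (\<Union>\<V>))"

text \<open>The width of the bracket is the indicator of the oscillation. For the empty family the
  lower function would be 1 and the upper one 0, whence \<open>\<V> \<noteq> {}\<close>.\<close>

lemma (in finite_measure) eps_bracket_osc_bracket:
  assumes "countable \<V>" "\<V> \<noteq> {}" "\<V> \<subseteq> sets M" "measure M (oscillation \<V>) \<le> \<epsilon>"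
  shows "eps_bracket \<epsilon> M (osc_bracket M \<V>)"
proof -
  have sets: "\<Union>\<V> \<in> sets M" "\<Inter>\<V> \<in> sets M"
    using assms(1-3) sets.countable_INT'[of \<V> id M] by (auto intro!: sets.countable_Union)
  have "\<Inter>\<V> \<subseteq> \<Union>\<V>" using assms(2) by blast
  have diff: "(indicator (\<Union>\<V>) x - indicator (\<Inter>\<V>) x :: real) = indicator (oscillation \<V>) x" for x
    using \<open>\<Inter>\<V> \<subseteq> \<Union>\<V>\<close> by (auto simp: oscillation_def indicator_def)
  have "oscillation \<V> \<in> sets M"
    using sets by (simp add: oscillation_def)
  then have "integrable M (indicator (oscillation \<V>) :: _ \<Rightarrow> real)"
      "(\<integral>x. indicator (oscillation \<V>) x \<partial>M) \<le> \<epsilon>"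
    using assms(4) by (auto simp: emeasure_eq_measure)
  moreover have "\<forall>x\<in>space M. (indicator (\<Inter>\<V>) x :: real) \<le> indicator (\<Union>\<V>) x"
    using \<open>\<Inter>\<V> \<subseteq> \<Union>\<V>\<close> by (auto simp: indicator_def)
  moreover have "(indicator (\<Inter>\<V>) :: _ \<Rightarrow> real) \<in> borel_measurable M"
      "(indicator (\<Union>\<V>) :: _ \<Rightarrow> real) \<in> borel_measurable M"
    using sets by auto
  ultimately show ?thesis
    unfolding eps_bracket_def osc_bracket_def diff[symmetric] by blast
qed

text \<open>By the pigeonhole principle infinitely many \<open>s n\<close> come from one piece.
  Along that subsequence its bracket bounds hold, and they survive the pointwise limit.\<close>

lemma limit_mem_osc_bracket:
  fixes s :: "nat \<Rightarrow> 'a \<Rightarrow> real"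
  assumes "finite \<W>" "\<And>n. s n \<in> indicators (\<Union>\<W>)"
    and "\<And>x. x \<in> space M \<Longrightarrow> (\<lambda>n. s n x) \<longlonglongrightarrow> f x" "f \<in> borel_measurable M"
  shows "\<exists>\<V>\<in>\<W> - {{}}. f \<in> osc_bracket M \<V>"
proof -
  have "\<exists>\<V>\<in>\<W>. s n \<in> indicators \<V>" for n
    using assms(2)[of n] by auto
  then obtain v where v: "\<And>n. v n \<in> \<W>" "\<And>n. s n \<in> indicators (v n)"
    by metis
  have "finite (range v)" using v(1) assms(1) by (meson finite_subset image_subsetI)
  then obtain m where "infinite {n. v n = v m}"
    using pigeonhole_infinite[of UNIV v] by auto
  then obtain r :: "nat \<Rightarrow> nat" where r: "strict_mono r" "\<And>k. v (r k) = v m"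
    using infinite_enumerate[of "{n. v n = v m}"] by blast
  have bnd: "indicator (\<Inter>(v m)) x \<le> s (r k) x \<and> s (r k) x \<le> indicator (\<Union>(v m)) x" for k x
    using v(2)[of "r k"] r(2)[of k] by (auto simp: indicator_def)
  have "indicator (\<Inter>(v m)) x \<le> f x \<and> f x \<le> indicator (\<Union>(v m)) x" if "x \<in> space M" for x
  proof -
    have "(\<lambda>k. s (r k) x) \<longlonglongrightarrow> f x"
      using LIMSEQ_subseq_LIMSEQ[OF assms(3)[OF that] r(1)] by (simp add: comp_def)
    then show ?thesis
      using bnd by (meson LIMSEQ_le_const LIMSEQ_le_const2)
  qed
  then have "f \<in> osc_bracket M (v m)"
    using assms(4) by (simp add: osc_bracket_def bracket_def)
  moreover have "v m \<noteq> {}" using v(2)[of m] by auto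
  ultimately show ?thesis using v(1) by blast
qed

text \<open>Returns from functions to sets: a countable set of indicators is the image of a
  countable subfamily.\<close>

lemma separable_indicatorsE:
  assumes "separable_family X (indicators \<C>)"
  obtains \<C>\<^sub>0 where "\<C>\<^sub>0 \<subseteq> \<C>" "countable \<C>\<^sub>0"
    "\<And>f. f \<in> indicators \<C> \<Longrightarrow>
      \<exists>s :: nat \<Rightarrow> _. (\<forall>n. s n \<in> indicators \<C>\<^sub>0) \<and> (\<forall>x\<in>X. (\<lambda>n. s n x) \<longlonglongrightarrow> f x)"
proof -
  obtain \<F>\<^sub>0 where \<F>\<^sub>0: "\<F>\<^sub>0 \<subseteq> indicators \<C>" "countable \<F>\<^sub>0"
    "\<And>f. f \<in> indicators \<C> \<Longrightarrow>
      \<exists>s :: nat \<Rightarrow> _. (\<forall>n. s n \<in> \<F>\<^sub>0) \<and> (\<forall>x\<in>X. (\<lambda>n. s n x) \<longlonglongrightarrow> f x)"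
    using assms unfolding separable_family_def by blast
  obtain \<C>\<^sub>0 where "\<C>\<^sub>0 \<subseteq> \<C>" "countable \<C>\<^sub>0" "\<F>\<^sub>0 = indicators \<C>\<^sub>0"
    using \<F>\<^sub>0(1,2) by (meson countable_subset_image)
  with \<F>\<^sub>0(3) show thesis by (intro that) auto
qed

theorem corollary1:
  fixes M :: "'a measure" and \<C> :: "'a set set"
  assumes "prob_space M"
    and "\<C> \<subseteq> sets M"
    and "VC_class (space M) \<C>"
    and "separable_family (space M) (indicators \<C>)"
  shows "\<forall>\<epsilon>>0. bracketing_number \<epsilon> (indicators \<C>) M < \<infinity>"
proof (intro allI impI)
  fix \<epsilon> :: real assume "0 < \<epsilon>"
  interpret prob_space M by fact
  obtain \<C>\<^sub>0 where \<C>\<^sub>0: "\<C>\<^sub>0 \<subseteq> \<C>" "countable \<C>\<^sub>0"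
    and approx: "\<And>f. f \<in> indicators \<C> \<Longrightarrow>
      \<exists>s :: nat \<Rightarrow> _. (\<forall>n. s n \<in> indicators \<C>\<^sub>0) \<and> (\<forall>x\<in>space M. (\<lambda>n. s n x) \<longlonglongrightarrow> f x)"
    using separable_indicatorsE[OF assms(4)] by blast
  have "osc_coverable \<epsilon> M \<C>\<^sub>0"
    using \<C>\<^sub>0 assms(2,3) \<open>0 < \<epsilon>\<close> by (intro osc_coverable_if_VC_class) auto
  then obtain \<W> where \<W>: "finite \<W>" "\<Union>\<W> = \<C>\<^sub>0" "\<And>\<V>. \<V> \<in> \<W> \<Longrightarrow> measure M (oscillation \<V>) \<le> \<epsilon>"
    unfolding osc_coverable_def by blast
  \<comment> \<open>Dropping the empty piece loses nothing, since it contributes no member to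
    \<open>\<C>\<^sub>0\<close>.\<close>
  define \<B> where "\<B> = osc_bracket M ` (\<W> - {{}})"
  have "eps_bracket \<epsilon> M B" if "B \<in> \<B>" for B
  proof -
    obtain \<V> where \<V>: "\<V> \<in> \<W>" "\<V> \<noteq> {}" "B = osc_bracket M \<V>"
      using \<open>B \<in> \<B>\<close> by (auto simp: \<B>_def)
    then have "\<V> \<subseteq> \<C>\<^sub>0" using \<W>(2) by blast
    then show ?thesis
      unfolding \<V>(3) using \<V> \<W>(3) \<C>\<^sub>0 assms(2)
      by (intro eps_bracket_osc_bracket) (auto intro: countable_subset)
  qed
  \<comment> \<open>Members of \<open>\<C>\<close> outside \<open>\<C>\<^sub>0\<close> are reached
    as limits, which stay in the same finitely many brackets.\<close>
  moreover have "indicators \<C> \<subseteq> \<Union>\<B>"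
  proof
    fix f :: "'a \<Rightarrow> real" assume f: "f \<in> indicators \<C>"
    obtain s :: "nat \<Rightarrow> 'a \<Rightarrow> real" where s: "\<And>n. s n \<in> indicators \<C>\<^sub>0"
        "\<And>x. x \<in> space M \<Longrightarrow> (\<lambda>n. s n x) \<longlonglongrightarrow> f x"
      using approx[OF f] by blast
    have "f \<in> borel_measurable M"
      using f assms(2) by auto
    then show "f \<in> \<Union>\<B>"
      using limit_mem_osc_bracket[of \<W> s M f] s \<W>(1,2) by (auto simp: \<B>_def)
  qed
  moreover have "finite \<B>" using \<W>(1) by (simp add: \<B>_def)
  ultimately have "bracketing_number \<epsilon> (indicators \<C>) M \<le> enat (card \<B>)"
    unfolding bracketing_number_def by (intro Inf_lower) blast
  then show "bracketing_number \<epsilon> (indicators \<C>) M < \<infinity>"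
    using enat_ord_simps(4) order_le_less_trans by blast
qed

end
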